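(* Let $a\in L^\infty(0,1)$ satisfy $\int_0^1a(x)\,dx<0$ and suppose there is $z\in(0,1)$ such that $a(x)>0$ for a.e. $x\in(0,z)$ and $a(x)<0$ for a.e. $x\in(z,1)$. Let $x_\omega$ be the unique point of $(z,1)$ with $\int_0^{x_\omega}a(x)\,dx=0$, and suppose that $$\operatorname*{ess\,sup}_{[z+\varepsilon,x_\omega]}a<0\quad\text{for all small }\varepsilon>0.$$ Let $f\in\mathcal C(\mathbb R)$ satisfy $f(0)=0$, $f(u)>0$ for $u>0$, and, for some constants $h>0$, $p>0$ and $q\in(0,1)$, $$\lim_{u\to0^+}\frac{f(u)}{u^p}=1,\qquad \lim_{u\to\infty}\frac{f(u)}{u^{-q}}=h.$$ Let $M>0$ be the maximal number with $f(M)=\max_{u\ge0}f(u)$, and suppose that $f\in\mathcal C^1[M,\infty)$, $f$ is increasing in $(0,M)$ and decreasing in $(M,\infty)$. Let $\{(\lambda_n,u_n)\}_{n\ge1}$ be a sequence such that $u_n$ is a regular strictly positive solution of $$-\left(\frac{u'}{\sqrt{1+(u')^2}}\right)'=\lambda_n a(x)f(u),\quad 0<x<1,\qquad u'(0)=u'(1)=0,$$ with $\lim_{n\to\infty}\lambda_n=\infty$ and $\liminf_{n\to\infty}u_n(0)>0$. Then, for every $\eta\in(0,1-z)$, there exist $C>0$ and $n_0\in\mathbb N$ such that $$u_n(x)\le C\lambda_n^{-1/p}\quad\text{for all }x\in[z+\eta,1]\text{ and }n\ge n_0.$$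
   Context: A regular solution is a function $u\in W^{2,1}(0,1)$ satisfying the equation a.e. in $(0,1)$ and the boundary conditions; it is strictly positive if $\min u>0$. "Increasing" and "decreasing" for $f$ are meant in the strict sense. *)

theory Defs
  imports "HOL-Probability.Essential_Supremum"
begin

definition essentially_bounded :: "real set \<Rightarrow> (real \<Rightarrow> real) \<Rightarrow> bool" where
  "essentially_bounded S a \<longleftrightarrow>
     a \<in> borel_measurable (lebesgue_on S) \<and> esssup (lebesgue_on S) (\<lambda>x. ereal \<bar>a x\<bar>) < \<infinity>"

text \<open>Test functions are taken of class \<open>C\<^sup>1\<close> with compact support in \<open>S\<close>, as is usual for Sobolev
  spaces on an open interval; smooth test functions give the same weak derivatives.\<close>

definition test_function :: "real set \<Rightarrow> (real \<Rightarrow> real) \<Rightarrow> bool" where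
  "test_function S \<phi> \<longleftrightarrow>
     \<phi> C1_differentiable_on UNIV \<and>
     compact (closure {x. \<phi> x \<noteq> 0}) \<and> closure {x. \<phi> x \<noteq> 0} \<subseteq> S"

text \<open>\<open>g\<close> is a weak derivative of \<open>u\<close> on the open set \<open>S\<close>, both functions being in \<open>L\<^sup>1(S)\<close>.\<close>

definition has_weak_derivative :: "real set \<Rightarrow> (real \<Rightarrow> real) \<Rightarrow> (real \<Rightarrow> real) \<Rightarrow> bool" where
  "has_weak_derivative S u g \<longleftrightarrow>
     integrable (lebesgue_on S) u \<and> integrable (lebesgue_on S) g \<and>
     (\<forall>\<phi>. test_function S \<phi> \<longrightarrow>
        (LINT x|lebesgue_on S. u x * deriv \<phi> x) = - (LINT x|lebesgue_on S. g x * \<phi> x))"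

text \<open>\<open>sobolev_W1 k S u\<close> means that \<open>u\<close> belongs to the Sobolev space \<open>W\<^sup>k\<^sup>,\<^sup>1(S)\<close>.\<close>

primrec sobolev_W1 :: "nat \<Rightarrow> real set \<Rightarrow> (real \<Rightarrow> real) \<Rightarrow> bool" where
  "sobolev_W1 0 S u \<longleftrightarrow> integrable (lebesgue_on S) u"
| "sobolev_W1 (Suc k) S u \<longleftrightarrow> (\<exists>v. has_weak_derivative S u v \<and> sobolev_W1 k S v)"

text \<open>A class in \<open>W\<^sup>2\<^sup>,\<^sup>1(0,1)\<close> has exactly one representative that is continuous on \<open>[0,1]\<close>, and this
  representative is of class \<open>C\<^sup>1\<close> on \<open>[0,1]\<close>; \<open>u\<close> is this representative, and the boundary values
  of \<open>u'\<close> are its one-sided derivatives. In the equation, \<open>v\<close> is \<open>u'\<close> and \<open>g\<close> is the derivative of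
  \<open>u' / sqrt (1 + u'\<^sup>2)\<close>, both determined up to null sets.\<close>

definition regular_solution ::
  "(real \<Rightarrow> real) \<Rightarrow> (real \<Rightarrow> real) \<Rightarrow> real \<Rightarrow> (real \<Rightarrow> real) \<Rightarrow> bool" where
  "regular_solution a f lam u \<longleftrightarrow>
     sobolev_W1 2 {0<..<1} u \<and> continuous_on {0..1} u \<and>
     (\<exists>v g. has_weak_derivative {0<..<1} u v \<and>
            has_weak_derivative {0<..<1} (\<lambda>x. v x / sqrt (1 + (v x)\<^sup>2)) g \<and>
            (AE x in lebesgue_on {0<..<1}. - g x = lam * a x * f (u x))) \<and>
     (u has_real_derivative 0) (at 0 within {0..1}) \<and>
     (u has_real_derivative 0) (at 1 within {0..1})"

text \<open>For \<open>u\<close> continuous on \<open>[0,1]\<close> the infimum is the minimum.\<close>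

definition strictly_positive :: "(real \<Rightarrow> real) \<Rightarrow> bool" where
  "strictly_positive u \<longleftrightarrow> 0 < (INF x\<in>{0..1}. u x)"

text \<open>Class \<open>C\<^sup>1[M, \<infinity>)\<close>, with the one-sided derivative at \<open>M\<close>.\<close>

definition C1_on_atLeast :: "real \<Rightarrow> (real \<Rightarrow> real) \<Rightarrow> bool" where
  "C1_on_atLeast M f \<longleftrightarrow>
     (\<exists>f'. continuous_on {M..} f' \<and>
           (\<forall>x\<in>{M..}. (f has_real_derivative f' x) (at x within {M..})))"

end

theory Submission
  imports Defs
begin

text \<open>Write \<open>w = u' / sqrt (1 + u'\<^sup>2)\<close> for the flux of a solution, so that \<open>w' = - \<lambda> a f(u)\<close> and
  \<open>w(0) = w(1) = 0\<close>. The sign change of \<open>a\<close> makes \<open>w\<close> first decrease and then increase, hence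
  \<open>- 1 < w \<le> 0\<close> and \<open>u\<close> is decreasing. The whole proof rests on the fact that \<open>w\<close> is bounded by \<open>1\<close>
  whatever \<open>\<lambda>\<close> is: on \<open>[z + \<epsilon>, x\<^sub>\<omega>]\<close>, where \<open>a \<le> - c < 0\<close>, the flux grows at rate at least
  \<open>\<lambda> c f(u)\<close>, so \<open>f(u)\<close> must be of order \<open>1 / \<lambda>\<close> somewhere in each interval of fixed length
  (lemma \<open>decay\<close>).

  Smallness of \<open>f(u)\<close> yields smallness of \<open>u\<close> only if large values of \<open>u\<close> are excluded, as \<open>f\<close>
  decays at infinity. This takes two steps. At \<open>x\<^sub>\<omega>\<close> one has \<open>u < M\<close>, since otherwise \<open>f(u)\<close> would be
  nondecreasing on \<open>[0, x\<^sub>\<omega>]\<close> and the vanishing mean of \<open>a\<close> would give \<open>w(x\<^sub>\<omega>) \<ge> 0\<close> (lemma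
  \<open>u_below_maximum\<close>). To the left of \<open>x\<^sub>\<omega>\<close> the graph of \<open>u\<close> has curvature at least
  \<open>K = \<lambda> c f(M + 1)\<close> while it descends from the height \<open>M + 1\<close> to \<open>M\<close>. A decreasing graph with
  curvature at least \<open>K\<close> descends by at most \<open>1 / K\<close>, as comparison with a circle of radius \<open>1 / K\<close>
  shows (lemma \<open>curvature_bounds_drop\<close>), so for large \<open>\<lambda>\<close> the height \<open>M + 1\<close> is not exceeded on
  \<open>[z + \<epsilon>, x\<^sub>\<omega>]\<close>. On \<open>(0, M + 1]\<close> one has \<open>f(s) \<ge> \<kappa> s\<^sup>p\<close> with some \<open>\<kappa> > 0\<close>, and
  \<open>f(u) = O(1 / \<lambda>)\<close> turns into \<open>u = O(\<lambda>\<^sup>-\<^sup>1\<^sup>/\<^sup>p)\<close>.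

  Solutions are given through weak derivatives, and the argument needs a differentiable \<open>u\<close> and a
  flux equal at every point to the integral of its derivative. The first half of the text supplies
  this: an integrable function with an integrable weak derivative on \<open>(0, 1)\<close> agrees almost
  everywhere with a primitive of it (lemma \<open>weak_derivative_imp_primitive\<close>).\<close>

section \<open>Spline test functions\<close>

text \<open>The test functions used for the weak derivative are the differences
  \<open>spline h d (t - x) - spline h d (t - y)\<close>. The function \<open>spline h d\<close> is the primitive, vanishing
  on \<open>s \<le> 0\<close>, of the trapezoid of height \<open>1\<close> on \<open>[0, h]\<close> with flanks of width \<open>d\<close>. It is constant
  for \<open>s \<ge> h\<close>, so the difference of two translates has compact support, and for \<open>d \<rightarrow> 0\<close> its
  derivative tends to the difference of the indicators of \<open>(x, x + h)\<close> and \<open>(y, y + h)\<close>. Written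
  with the primitive \<open>half_square\<close> of the positive part it is of class \<open>C\<^sup>1\<close> without any case
  distinction.\<close>

definition half_square :: "real \<Rightarrow> real" where
  "half_square s = (max 0 s)\<^sup>2 / 2"

definition ramp :: "real \<Rightarrow> real \<Rightarrow> real" where
  "ramp d s = (max 0 s - max 0 (s - d)) / d"

definition spline :: "real \<Rightarrow> real \<Rightarrow> real \<Rightarrow> real" where
  "spline h d s =
     (half_square s - half_square (s - d)) / d
     - (half_square (s - h + d) - half_square (s - h)) / d"

lemma half_square_deriv: "(half_square has_real_derivative max 0 s) (at s)"
proof (cases s "0::real" rule: linorder_cases)
  case less
  have "((\<lambda>s::real. 0) has_real_derivative 0) (at s)" by simp
  moreover have "eventually (\<lambda>s. 0 = half_square s) (nhds s)"
    using eventually_nhds_in_open[of "{..<0}" s] less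
    by (auto simp: half_square_def elim!: eventually_mono)
  ultimately have "(half_square has_real_derivative 0) (at s)"
    using DERIV_cong_ev[of s s "\<lambda>_. 0" half_square 0 0] by simp
  then show ?thesis using less by simp
next
  case equal
  have "((\<lambda>h. half_square h / h) \<longlongrightarrow> 0) (at 0)"
  proof (rule Lim_null_comparison)
    show "\<forall>\<^sub>F h in at 0. norm (half_square h / h) \<le> \<bar>h\<bar>"
      by (auto simp: half_square_def power2_eq_square max_def intro!: always_eventually)
    show "((\<lambda>h. \<bar>h\<bar>) \<longlongrightarrow> 0) (at (0::real))"
      by (rule tendsto_eq_intros | simp)+
  qed
  then show ?thesis using equal
    by (simp add: DERIV_def half_square_def)
next
  case greater
  have "((\<lambda>s::real. s\<^sup>2 / 2) has_real_derivative s) (at s)"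
    by (auto intro!: derivative_eq_intros)
  moreover have "eventually (\<lambda>s. s\<^sup>2 / 2 = half_square s) (nhds s)"
    using eventually_nhds_in_open[of "{0<..}" s] greater
    by (auto simp: half_square_def elim!: eventually_mono)
  ultimately have "(half_square has_real_derivative s) (at s)"
    using DERIV_cong_ev[of s s "\<lambda>s. s\<^sup>2 / 2" half_square s s] by simp
  then show ?thesis using greater by simp
qed

lemma spline_deriv:
  assumes "d > 0"
  shows "(spline h d has_real_derivative ramp d s - ramp d (s - h + d)) (at s)"
proof -
  have [derivative_intros]: "((\<lambda>x. half_square (x - c)) has_real_derivative max 0 (s - c)) (at s)" for c
    using DERIV_shift[of half_square "max 0 (s - c)" s "- c"] half_square_deriv[of "s - c"] by simp
  note half_square_deriv[derivative_intros]
  have "((\<lambda>s. (half_square s - half_square (s - d)) / d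
     - (half_square (s - (h - d)) - half_square (s - h)) / d) has_real_derivative 
     ramp d s - ramp d (s - (h - d))) (at s)"
    unfolding ramp_def
    using assms by (auto intro!: derivative_eq_intros simp: divide_simps)
  moreover have "spline h d = (\<lambda>s. (half_square s - half_square (s - d)) / d
     - (half_square (s - (h - d)) - half_square (s - h)) / d)"
    by (rule ext) (simp add: spline_def algebra_simps)
  ultimately show ?thesis by (simp add: algebra_simps)
qed

lemma ramp_bounds:
  assumes "d > 0" shows "0 \<le> ramp d s" "ramp d s \<le> 1"
  using assms by (auto simp: ramp_def divide_simps max_def)

text \<open>The difference quotient of \<open>half_square\<close> is a mean value of its nondecreasing derivative.
  This makes the convergence of the splines uniform with an explicit rate.\<close>

lemma half_square_quotient_bounds:
  assumes "d > 0"
  shows "max 0 (s - d) \<le> (half_square s - half_square (s - d)) / d"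
    and "(half_square s - half_square (s - d)) / d \<le> max 0 s"
proof -
  define A B where "A = max 0 s" and "B = max 0 (s - d)"
  have AB: "0 \<le> B" "B \<le> A" "A - B \<le> d" "A = 0 \<or> A \<le> d \<and> B = 0 \<or> A - B = d"
    using assms by (auto simp: A_def B_def max_def)
  have e: "(half_square s - half_square (s - d)) / d = (A - B) * (A + B) / (2 * d)"
    by (simp add: half_square_def A_def B_def power2_eq_square field_simps)
  have "(A - B) * (A + B) \<le> d * (2 * A)"
    by (rule mult_mono) (use AB in auto)
  then show "(half_square s - half_square (s - d)) / d \<le> max 0 s"
    unfolding e using assms by (simp add: A_def[symmetric] divide_simps algebra_simps)
  have "B * (2 * d) \<le> (A - B) * (A + B)"
    using AB(4)
  proof (elim disjE)
    assume "A - B = d"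
    then have "(A - B) * (A + B) = d * (2 * B + d)" by (simp add: algebra_simps)
    then show ?thesis using assms by (simp add: algebra_simps)
  qed (use AB in auto)
  then show "max 0 (s - d) \<le> (half_square s - half_square (s - d)) / d"
    unfolding e using assms by (simp add: B_def[symmetric] pos_le_divide_eq)
qed

text \<open>The limit of \<open>spline h d\<close> as \<open>d \<rightarrow> 0\<close>.\<close>

definition clamp0 :: "real \<Rightarrow> real \<Rightarrow> real" where
  "clamp0 h s = max 0 (min s h)"

lemma spline_clamp:
  assumes "d > 0" "h > 0"
  shows "\<bar>spline h d s - clamp0 h s\<bar> \<le> 2 * d"
proof -
  have "clamp0 h s = max 0 s - max 0 (s - h)" using assms by (auto simp: clamp0_def max_def min_def)
  moreover have "max 0 s - d \<le> max 0 (s - d)" "max 0 (s - h + d) \<le> max 0 (s - h) + d"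
    using assms by (auto simp: max_def)
  ultimately show ?thesis
    using half_square_quotient_bounds[OF assms(1), of s]
      half_square_quotient_bounds[OF assms(1), of "s - h + d"]
    unfolding spline_def by auto
qed

lemma spline_zero: "d > 0 \<Longrightarrow> d \<le> h \<Longrightarrow> s \<le> 0 \<Longrightarrow> spline h d s = 0"
  by (simp add: spline_def half_square_def)

lemma spline_const: "d > 0 \<Longrightarrow> d \<le> h \<Longrightarrow> s \<ge> h \<Longrightarrow> spline h d s = h - d"
  by (simp add: spline_def half_square_def max_def power2_eq_square field_simps)

lemma spline_test_function:
  assumes "0 < d" "d \<le> h" "0 < x" "x < y" "y + h < 1"
  shows "test_function {0<..<1} (\<lambda>t. spline h d (t - x) - spline h d (t - y))"
    and "deriv (\<lambda>t. spline h d (t - x) - spline h d (t - y)) t =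
      (ramp d (t - x) - ramp d (t - x - h + d)) - (ramp d (t - y) - ramp d (t - y - h + d))"
proof -
  let ?\<phi> = "\<lambda>t. spline h d (t - x) - spline h d (t - y)"
  let ?D = "\<lambda>t. (ramp d (t - x) - ramp d (t - x - h + d)) - (ramp d (t - y) - ramp d (t - y - h + d))"
  have sh: "((\<lambda>t. spline h d (t - c)) has_real_derivative 
      ramp d (t - c) - ramp d (t - c - h + d)) (at t)" for t c
    using DERIV_shift[of "spline h d" _ t "- c"] spline_deriv[OF assms(1), of h "t - c"] by simp
  have D: "(?\<phi> has_real_derivative ?D t) (at t)" for t
    by (intro DERIV_diff sh)
  then show "deriv ?\<phi> t = ?D t" by (rule DERIV_imp_deriv)
  have "continuous_on UNIV ?D"
    unfolding ramp_def using assms by (intro continuous_intros) auto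
  then have C1: "?\<phi> C1_differentiable_on UNIV"
    unfolding C1_differentiable_on_def
    using D by (intro exI[of _ ?D]) (auto simp: has_real_derivative_iff_has_vector_derivative)
  have "?\<phi> t = 0" if "t \<notin> {x..y+h}" for t
  proof (cases "t < x")
    case True then show ?thesis using assms by (simp add: spline_zero)
  next
    case False then show ?thesis using assms that by (simp add: spline_const)
  qed
  then have "{t. ?\<phi> t \<noteq> 0} \<subseteq> {x..y+h}" by blast
  then have sub: "closure {t. ?\<phi> t \<noteq> 0} \<subseteq> {x..y+h}"
    by (rule closure_minimal) (rule closed_real_atLeastAtMost)
  have "compact ({x..y+h} \<inter> closure {t. ?\<phi> t \<noteq> 0})"
    by (intro compact_Int_closed compact_Icc closed_closure)
  then have "compact (closure {t. ?\<phi> t \<noteq> 0})"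
    unfolding Int_absorb1[OF sub] .
  moreover have "{x..y+h} \<subseteq> {0<..<1}" using assms by auto
  ultimately show "test_function {0<..<1} ?\<phi>"
    unfolding test_function_def using C1 sub by blast
qed

section \<open>Functions with an integrable weak derivative\<close>

lemma const_over_Suc_tendsto: "(\<lambda>n. c / real (Suc n)) \<longlonglongrightarrow> 0"
  by (rule LIMSEQ_Suc[OF lim_const_over_n])

lemma ramp_difference_tendsto:
  assumes "h > 0"
  shows "(\<lambda>n. ramp (h / real (Suc n)) s - ramp (h / real (Suc n)) (s - h + h / real (Suc n)))
    \<longlonglongrightarrow> indicator {0<..<h} s"
proof -
  have d: "0 < h / real (Suc n)" "h / real (Suc n) \<le> h" for n
    using assms by (auto simp: divide_simps)
  consider "s \<le> 0" | "0 < s" "s < h" | "h \<le> s" by linarith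
  then show ?thesis
  proof cases
    case 1
    have "ramp d s - ramp d (s - h + d) = 0" if "d \<le> h" "0 < d" for d
      using that 1 by (simp add: ramp_def)
    then show ?thesis using 1 d by simp
  next
    case 2
    have "(\<lambda>n. h / real (Suc n)) \<longlonglongrightarrow> 0"
      by (rule const_over_Suc_tendsto)
    from order_tendstoD(2)[OF this, of "min s (h - s)"] 2
    have "\<forall>\<^sub>F n in sequentially. h / real (Suc n) < min s (h - s)" by simp
    then have "\<forall>\<^sub>F n in sequentially. ramp (h / real (Suc n)) s - ramp (h / real (Suc n)) (s - h + h / real (Suc n)) = 1"
    proof (rule eventually_mono)
      fix n assume "h / real (Suc n) < min s (h - s)"
      then show "ramp (h / real (Suc n)) s - ramp (h / real (Suc n)) (s - h + h / real (Suc n)) = 1"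
        using d[of n] 2 by (simp add: ramp_def del: of_nat_Suc)
    qed
    then show ?thesis using 2 by (simp add: tendsto_eventually)
  next
    case 3
    have "ramp d s - ramp d (s - h + d) = 0" if "d \<le> h" "0 < d" for d
      using that 3 by (simp add: ramp_def)
    then show ?thesis using 3 d by simp
  qed
qed

lemma integral_indicator_Ioo:
  fixes W :: "real \<Rightarrow> real"
  assumes "integrable lebesgue W"
  shows "integrable lebesgue (\<lambda>t. W t * indicator {0<..<h} (t - x))"
    and "(LINT t|lebesgue. W t * indicator {0<..<h} (t - x)) = integral {x..x+h} W"
proof -
  have e: "W t * indicator {0<..<h} (t - x) = indicator {x<..<x+h} t *\<^sub>R W t" for t
    by (auto simp: indicator_def)
  have i: "set_integrable lebesgue {x<..<x+h} W"
    unfolding set_integrable_def using assms by (intro integrable_mult_indicator) auto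
  then show "integrable lebesgue (\<lambda>t. W t * indicator {0<..<h} (t - x))"
    unfolding e set_integrable_def .
  show "(LINT t|lebesgue. W t * indicator {0<..<h} (t - x)) = integral {x..x+h} W"
    using set_lebesgue_integral_eq_integral(2)[OF i]
    unfolding e set_lebesgue_integral_def by (simp add: integral_open_interval_real)
qed

lemma clamp0_measurable [measurable]: "clamp0 h \<in> borel_measurable borel"
  unfolding clamp0_def by measurable

lemma ramp_measurable [measurable]: "ramp d \<in> borel_measurable borel"
  unfolding ramp_def by measurable

lemma lebesgue_shift_measurable:
  assumes "F \<in> borel_measurable borel"
  shows "(\<lambda>t::real. F (t - c) :: real) \<in> borel_measurable lebesgue"
proof -
  have "(\<lambda>t::real. F (t - c)) \<in> borel_measurable borel" using assms by measurable
  then show ?thesis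
    by (intro measurable_completion) simp
qed

text \<open>Extending the functions by zero to the whole line keeps all integrals on one measure space
  and provides the integrability on all intervals that Lebesgue's differentiation theorem asks
  for.\<close>

locale weak_derivative_line =
  fixes W g :: "real \<Rightarrow> real"
  assumes W: "integrable lebesgue W" and g: "integrable lebesgue g"
    and test: "\<And>\<phi>. test_function {0<..<1} \<phi> \<Longrightarrow>
      (LINT x|lebesgue. W x * deriv \<phi> x) = - (LINT x|lebesgue. g x * \<phi> x)"
begin

text \<open>This is the weak identity for the Lipschitz function \<open>clamp0 h (t - x) - clamp0 h (t - y)\<close>,
  obtained from its \<open>C\<^sup>1\<close> approximations by dominated convergence on both sides.\<close>

lemma box_averages:
  assumes h: "0 < h" and xy: "0 < x" "x < y" "y + h < 1"
  shows "integral {x..x+h} W - integral {y..y+h} W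
    = - (LINT t|lebesgue. g t * (clamp0 h (t - x) - clamp0 h (t - y)))"
proof -
  define d where "d n = h / real (Suc n)" for n
  have d: "0 < d n" "d n \<le> h" for n
    using h by (auto simp: d_def divide_simps)
  have d0: "d \<longlonglongrightarrow> 0" unfolding d_def
    by (rule const_over_Suc_tendsto)
  define \<phi> where "\<phi> n t = spline h (d n) (t - x) - spline h (d n) (t - y)" for n t
  define R where "R n s = ramp (d n) s - ramp (d n) (s - h + d n)" for n s
  have tf: "test_function {0<..<1} (\<phi> n)" "deriv (\<phi> n) t = R n (t - x) - R n (t - y)" for n t
    using spline_test_function[OF d xy] by (auto simp: \<phi>_def[abs_def] R_def)
  have R1: "\<bar>R n s\<bar> \<le> 1" for n s
    using ramp_bounds[OF d(1)[of n], of s] ramp_bounds[OF d(1)[of n], of "s - h + d n"]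
    unfolding R_def by linarith
  have Rm: "R n \<in> borel_measurable borel" for n
    unfolding R_def[abs_def] by measurable
  have Rl: "(\<lambda>n. R n s) \<longlonglongrightarrow> indicator {0<..<h} s" for s
    using ramp_difference_tendsto[OF h] unfolding R_def d_def .
  have L: "(\<lambda>n. LINT t|lebesgue. W t * deriv (\<phi> n) t) \<longlonglongrightarrow>
      (LINT t|lebesgue. W t * (indicator {0<..<h} (t - x) - indicator {0<..<h} (t - y)))"
  proof (rule integral_dominated_convergence[where w = "\<lambda>t. 2 * \<bar>W t\<bar>"])
    have "(\<lambda>t. W t * indicator {0<..<h} (t - x) - W t * indicator {0<..<h} (t - y)) \<in> borel_measurable lebesgue"
      using integral_indicator_Ioo(1)[OF W] by (intro borel_measurable_diff) auto
    then show "(\<lambda>t. W t * (indicator {0<..<h} (t - x) - indicator {0<..<h} (t - y))) \<in> borel_measurable lebesgue"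
      by (simp add: right_diff_distrib)
    show "(\<lambda>t. W t * deriv (\<phi> n) t) \<in> borel_measurable lebesgue" for n
      unfolding tf using W lebesgue_shift_measurable[OF Rm]
      by (intro borel_measurable_times borel_measurable_diff) auto
    show "integrable lebesgue (\<lambda>t. 2 * \<bar>W t\<bar>)" using W by simp
    show "AE t in lebesgue. (\<lambda>n. W t * deriv (\<phi> n) t) \<longlonglongrightarrow> W t * (indicator {0<..<h} (t - x) - indicator {0<..<h} (t - y))"
      unfolding tf by (intro always_eventually allI tendsto_intros Rl)
    show "AE t in lebesgue. norm (W t * deriv (\<phi> n) t) \<le> 2 * \<bar>W t\<bar>" for n
    proof (intro always_eventually allI)
      fix t
      have "\<bar>R n (t - x) - R n (t - y)\<bar> \<le> 2" using R1[of n "t - x"] R1[of n "t - y"] by linarith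
      then show "norm (W t * deriv (\<phi> n) t) \<le> 2 * \<bar>W t\<bar>"
        unfolding tf by (simp add: abs_mult mult.commute mult_left_mono)
    qed
  qed
  moreover have "(\<lambda>n. - (LINT t|lebesgue. g t * \<phi> n t)) \<longlonglongrightarrow>
      - (LINT t|lebesgue. g t * (clamp0 h (t - x) - clamp0 h (t - y)))"
  proof (intro tendsto_minus integral_dominated_convergence[where w = "\<lambda>t. (6 * h) * \<bar>g t\<bar>"])
    show "(\<lambda>t. g t * (clamp0 h (t - x) - clamp0 h (t - y))) \<in> borel_measurable lebesgue"
      using g lebesgue_shift_measurable[of "clamp0 h"]
      by (intro borel_measurable_times borel_measurable_diff) auto
    show "(\<lambda>t. g t * \<phi> n t) \<in> borel_measurable lebesgue" for n
    proof -
      have "spline h (d n) \<in> borel_measurable borel"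
        unfolding spline_def half_square_def by measurable
      then show ?thesis unfolding \<phi>_def
        using g lebesgue_shift_measurable
        by (intro borel_measurable_times borel_measurable_diff) auto
    qed
    show "integrable lebesgue (\<lambda>t. (6 * h) * \<bar>g t\<bar>)" using g by simp
    have S: "(\<lambda>n. spline h (d n) s) \<longlonglongrightarrow> clamp0 h s" for s
    proof -
      have "(\<lambda>n. spline h (d n) s - clamp0 h s) \<longlonglongrightarrow> 0"
      proof (rule Lim_null_comparison)
        show "\<forall>\<^sub>F n in sequentially. norm (spline h (d n) s - clamp0 h s) \<le> 2 * d n"
          using spline_clamp[OF d(1) h] by simp
        show "(\<lambda>n. 2 * d n) \<longlonglongrightarrow> 0" using tendsto_mult[OF tendsto_const[of 2] d0] by simp
      qed
      then show ?thesis by (simp add: LIM_zero_iff)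
    qed
    show "AE t in lebesgue. (\<lambda>n. g t * \<phi> n t) \<longlonglongrightarrow> g t * (clamp0 h (t - x) - clamp0 h (t - y))"
      unfolding \<phi>_def by (intro always_eventually allI tendsto_intros S)
    show "AE t in lebesgue. norm (g t * \<phi> n t) \<le> (6 * h) * \<bar>g t\<bar>" for n
    proof (intro always_eventually allI)
      fix t
      have "\<bar>clamp0 h s\<bar> \<le> h" for s using h by (simp add: clamp0_def)
      then have "\<bar>spline h (d n) s\<bar> \<le> 3 * h" for s
        using spline_clamp[OF d(1)[of n] h, of s] d(2)[of n] by (smt (verit))
      then have "\<bar>\<phi> n t\<bar> \<le> 6 * h" unfolding \<phi>_def by (smt (verit))
      then show "norm (g t * \<phi> n t) \<le> (6 * h) * \<bar>g t\<bar>"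
        by (simp add: abs_mult mult.commute mult_left_mono)
    qed
  qed
  ultimately have "(LINT t|lebesgue. W t * (indicator {0<..<h} (t - x) - indicator {0<..<h} (t - y)))
      = - (LINT t|lebesgue. g t * (clamp0 h (t - x) - clamp0 h (t - y)))"
    using LIMSEQ_unique unfolding test[OF tf(1)] by blast
  then show ?thesis
    using integral_indicator_Ioo[OF W] by (simp add: right_diff_distrib)
qed

text \<open>Dividing the previous identity by \<open>h\<close> and letting \<open>h \<rightarrow> 0\<close>, the averages of \<open>W\<close> converge
  to its values almost everywhere by Lebesgue's theorem, while the weight of \<open>g\<close> converges
  boundedly to the indicator of \<open>(x, y]\<close>.\<close>

lemma difference_eq_integral:
  obtains N where "negligible N"
    "\<And>x y. x \<in> {0<..<1} - N \<Longrightarrow> y \<in> {0<..<1} - N \<Longrightarrow> x < y \<Longrightarrow> W y - W x = integral {x..y} g"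
proof -
  have int: "F integrable_on cbox a b" if "integrable lebesgue F" for F :: "real \<Rightarrow> real" and a b
    using integrable_on_lebesgue[OF that] integrable_on_subcbox by blast
  obtain N where N: "negligible N"
    "\<And>x e. \<lbrakk>x \<notin> N; 0 < e\<rbrakk> \<Longrightarrow> \<exists>d>0. \<forall>h. 0 < h \<and> h < d \<longrightarrow>
       norm (integral (cbox x (x + h *\<^sub>R One)) W /\<^sub>R h ^ DIM(real) - W x) < e"
    using integrable_ccontinuous_explicit[OF int[OF W]] by metis
  have avg: "(\<lambda>n. integral {x..x + h n} W / h n) \<longlonglongrightarrow> W x"
    if avg: "x \<notin> N" "h \<longlonglongrightarrow> 0" "\<And>n. h n > 0" for x and h :: "nat \<Rightarrow> real"
  proof (rule LIMSEQ_I)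
    fix e :: real assume "0 < e"
    then obtain d where d: "d > 0" "\<And>h. 0 < h \<Longrightarrow> h < d \<Longrightarrow>
       norm (integral (cbox x (x + h *\<^sub>R One)) W /\<^sub>R h ^ DIM(real) - W x) < e"
      using N(2)[OF avg(1) \<open>0 < e\<close>] by auto
    obtain n0 where "\<And>n. n \<ge> n0 \<Longrightarrow> h n < d"
      using order_tendstoD(2)[OF avg(2) d(1)] by (auto simp: eventually_sequentially)
    then show "\<exists>no. \<forall>n\<ge>no. norm (integral {x..x + h n} W / h n - W x) < e"
      using d(2)[OF avg(3)] by (intro exI[of _ n0]) (auto simp: divide_inverse mult.commute)
  qed
  show thesis
  proof (rule that[OF N(1)])
    fix x y assume x: "x \<in> {0<..<1} - N" and y: "y \<in> {0<..<1} - N" and xy: "x < y"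
    \<comment> \<open>The factor \<open>(1 - y) / 2\<close> keeps both intervals inside \<open>(0, 1)\<close>.\<close>
    define h where "h n = ((1 - y) / 2) / real (Suc n)" for n
    have h: "h n > 0" "y + h n < 1" for n
    proof -
      show "h n > 0" using y by (simp add: h_def)
      have "h n \<le> (1 - y) / 2 / 1" unfolding h_def
        using y by (intro divide_left_mono) auto
      then show "y + h n < 1" using y by (simp add: field_simps)
    qed
    have h0: "h \<longlonglongrightarrow> 0" unfolding h_def
      by (rule const_over_Suc_tendsto)
    have cl: "(\<lambda>n. clamp0 (h n) s / h n) \<longlonglongrightarrow> indicator {0<..} s" for s
    proof (cases "s > 0")
      case True
      from order_tendstoD(2)[OF h0 this]
      have "\<forall>\<^sub>F n in sequentially. clamp0 (h n) s / h n = 1"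
      proof (rule eventually_mono)
        fix n assume "h n < s"
        then show "clamp0 (h n) s / h n = 1" using h(1)[of n] by (simp add: clamp0_def min_def)
      qed
      then show ?thesis using True by (simp add: tendsto_eventually)
    next
      case False
      then have "clamp0 (h n) s / h n = 0" for n
        using h(1)[of n] by (simp add: clamp0_def min_def)
      then show ?thesis using False by (simp only:) simp
    qed
    have "(\<lambda>n. (integral {x..x + h n} W - integral {y..y + h n} W) / h n) \<longlonglongrightarrow> W x - W y"
      unfolding diff_divide_distrib using x y h0 h by (intro tendsto_diff avg) auto
    moreover have "(integral {x..x + h n} W - integral {y..y + h n} W) / h n
        = - (LINT t|lebesgue. g t * (clamp0 (h n) (t - x) / h n - clamp0 (h n) (t - y) / h n))" for n
    proof -
      have "(LINT t|lebesgue. g t * (clamp0 (h n) (t - x) / h n - clamp0 (h n) (t - y) / h n))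
        = (LINT t|lebesgue. g t * (clamp0 (h n) (t - x) - clamp0 (h n) (t - y))) / h n"
        unfolding diff_divide_distrib[symmetric] times_divide_eq_right by simp
      then show ?thesis using box_averages[OF h(1) _ xy h(2)] x by simp
    qed
    moreover have "(\<lambda>n. - (LINT t|lebesgue. g t * (clamp0 (h n) (t - x) / h n - clamp0 (h n) (t - y) / h n)))
      \<longlonglongrightarrow> - (LINT t|lebesgue. g t * (indicator {0<..} (t - x) - indicator {0<..} (t - y)))"
    proof (intro tendsto_minus integral_dominated_convergence[where w = "\<lambda>t. 2 * \<bar>g t\<bar>"])
      show "(\<lambda>t. g t * (indicator {0<..} (t - x) - indicator {0<..} (t - y))) \<in> borel_measurable lebesgue"
        using g by (intro borel_measurable_times borel_measurable_diff lebesgue_shift_measurable) auto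
      show "(\<lambda>t. g t * (clamp0 (h n) (t - x) / h n - clamp0 (h n) (t - y) / h n)) \<in> borel_measurable lebesgue" for n
        using g by (intro borel_measurable_times borel_measurable_diff 
            lebesgue_shift_measurable[of "\<lambda>s. clamp0 (h n) s / h n"]) auto
      show "integrable lebesgue (\<lambda>t. 2 * \<bar>g t\<bar>)" using g by simp
      show "AE t in lebesgue. (\<lambda>n. g t * (clamp0 (h n) (t - x) / h n - clamp0 (h n) (t - y) / h n))
        \<longlonglongrightarrow> g t * (indicator {0<..} (t - x) - indicator {0<..} (t - y))"
        by (intro always_eventually allI tendsto_intros cl)
      show "AE t in lebesgue. norm (g t * (clamp0 (h n) (t - x) / h n - clamp0 (h n) (t - y) / h n)) \<le> 2 * \<bar>g t\<bar>" for n
      proof (intro always_eventually allI)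
        fix t
        have "\<bar>clamp0 (h n) s / h n\<bar> \<le> 1" for s using h(1)[of n] by (simp add: clamp0_def)
        from this[of "t - x"] this[of "t - y"]
        have "\<bar>clamp0 (h n) (t - x) / h n - clamp0 (h n) (t - y) / h n\<bar> \<le> 2" by linarith
        then show "norm (g t * (clamp0 (h n) (t - x) / h n - clamp0 (h n) (t - y) / h n)) \<le> 2 * \<bar>g t\<bar>"
          unfolding real_norm_def abs_mult by (metis abs_ge_zero mult.commute mult_left_mono)
      qed
    qed
    ultimately have "W x - W y = - (LINT t|lebesgue. g t * (indicator {0<..} (t - x) - indicator {0<..} (t - y)))"
      using LIMSEQ_unique by fastforce
    moreover have "(LINT t|lebesgue. g t * (indicator {0<..} (t - x) - indicator {0<..} (t - y)))
      = (LINT t:{x<..y}|lebesgue. g t)"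
      unfolding set_lebesgue_integral_def using xy
      by (intro Bochner_Integration.integral_cong) (auto simp: indicator_def)
    moreover have "(LINT t:{x<..y}|lebesgue. g t) = integral {x<..y} g"
    proof (rule set_lebesgue_integral_eq_integral(2))
      show "set_integrable lebesgue {x<..y} g"
        unfolding set_integrable_def using g by (intro integrable_mult_indicator) auto
    qed
    moreover have "integral {x<..y} g = integral {x..y} g"
    proof (rule integral_subset_negligible)
      have "{x..y} - {x<..y} \<subseteq> {x}" by auto
      then show "negligible ({x..y} - {x<..y})" using negligible_subset negligible_sing by blast
    qed auto
    ultimately show "W y - W x = integral {x..y} g" by simp
  qed
qed

end

lemma AE_lebesgue_negligible:
  assumes "AE x in lebesgue. P x"
  obtains N where "negligible N" "\<And>x. x \<notin> N \<Longrightarrow> P x"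
  using assms by (elim AE_E3) (auto simp: negligible_iff_null_sets)

lemma negligible_AE_lebesgue:
  assumes "negligible N" "\<And>x. x \<notin> N \<Longrightarrow> P x"
  shows "AE x in lebesgue. P x"
  using assms by (auto simp: negligible_iff_null_sets eventually_ae_filter)

lemma AE_lebesgue_on_iff:
  assumes "S \<in> sets lebesgue"
  shows "(AE x in lebesgue_on S. P x) \<longleftrightarrow> (AE x in lebesgue. x \<in> S \<longrightarrow> P x)"
  using assms by (subst AE_restrict_space_iff) auto

lemma abs_integrable_unit:
  fixes g :: "real \<Rightarrow> real"
  assumes "integrable (lebesgue_on {0<..<1}) g"
  shows "g absolutely_integrable_on {0..1}"
proof -
  have "set_integrable lebesgue {0<..<1} g"
    using assms by (simp add: set_integrable_def integrable_restrict_space)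
  then show ?thesis
    using absolutely_integrable_on_open_interval[where f = g and a = 0 and b = 1] by simp
qed

lemma integral_diff_lower:
  fixes g :: "real \<Rightarrow> real"
  assumes "g absolutely_integrable_on {0..1}" "0 \<le> x" "x \<le> y" "y \<le> 1"
  shows "integral {0..y} g - integral {0..x} g = integral {x..y} g"
proof -
  have "g integrable_on {0..y}"
    using assms(1) set_lebesgue_integral_eq_integral(1) integrable_subinterval_real assms(4) by fastforce
  from Henstock_Kurzweil_Integration.integral_combine[OF assms(2,3) this] show ?thesis by simp
qed

lemma weak_derivative_imp_primitive:
  assumes "has_weak_derivative {0<..<1} W g"
  obtains c where "g absolutely_integrable_on {0..1}"
    "AE x in lebesgue. x \<in> {0<..<1} \<longrightarrow> W x = c + integral {0..x} g"
proof -
  let ?W = "\<lambda>x. indicator {0<..<1} x * W x" and ?g = "\<lambda>x. indicator {0<..<1} x * g x"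
  have i: "integrable (lebesgue_on {0<..<1}) W" "integrable (lebesgue_on {0<..<1}) g"
    and t: "\<And>\<phi>. test_function {0<..<1} \<phi> \<Longrightarrow>
        (LINT x|lebesgue_on {0<..<1}. W x * deriv \<phi> x) = - (LINT x|lebesgue_on {0<..<1}. g x * \<phi> x)"
    using assms by (auto simp: has_weak_derivative_def)
  interpret weak_derivative_line ?W ?g
  proof
    show "integrable lebesgue ?W" "integrable lebesgue ?g"
      using i by (simp_all add: integrable_restrict_space)
    show "(LINT x|lebesgue. ?W x * deriv \<phi> x) = - (LINT x|lebesgue. ?g x * \<phi> x)"
      if "test_function {0<..<1} \<phi>" for \<phi>
      using t[OF that] by (simp add: integral_restrict_space mult.assoc)
  qed
  have gi: "g absolutely_integrable_on {0..1}" using abs_integrable_unit[OF i(2)] .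
  obtain N where N: "negligible N"
    "\<And>x y. x \<in> {0<..<1} - N \<Longrightarrow> y \<in> {0<..<1} - N \<Longrightarrow> x < y \<Longrightarrow> ?W y - ?W x = integral {x..y} ?g"
    using difference_eq_integral by blast
  have diff: "W y - W x = integral {0..y} g - integral {0..x} g"
    if "x \<in> {0<..<1} - N" "y \<in> {0<..<1} - N" "x < y" for x y
  proof -
    have "integral {x..y} ?g = integral {x..y} g"
      using that by (intro integral_cong) auto
    then show ?thesis using N(2)[OF that] that integral_diff_lower[OF gi, of x y] by simp
  qed
  have "\<not> {0<..<1::real} \<subseteq> N"
    using negligible_subset[OF N(1)] open_not_negligible[of "{0<..<1::real}"] by auto
  then obtain x0 where x0: "x0 \<in> {0<..<1} - N" by blast
  show thesis
  proof (rule that[OF gi], rule negligible_AE_lebesgue[OF N(1)], intro impI)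
    fix x assume "x \<notin> N" "x \<in> {0<..<1::real}"
    then show "W x = (W x0 - integral {0..x0} g) + integral {0..x} g"
      using diff[OF x0, of x] diff[OF _ x0, of x] by (cases x x0 rule: linorder_cases) auto
  qed
qed

lemma AE_eq_imp_eq:
  fixes F G :: "real \<Rightarrow> real"
  assumes "AE x in lebesgue. x \<in> {0<..<1} \<longrightarrow> F x = G x"
    and F: "continuous_on {0..1} F" and G: "continuous_on {0..1} G" and x: "x \<in> {0..1}"
  shows "F x = G x"
proof -
  let ?C = "{x \<in> {0..1}. F x - G x = 0}"
  have "continuous_on {0..1} (\<lambda>x. F x - G x)" using F G by (intro continuous_intros)
  then have C: "closed ?C"
    using continuous_closed_preimage_constant[of "{0..1}" "\<lambda>x. F x - G x" 0] by simp
  have "AE x \<in> {0<..<1} in lebesgue. x \<in> ?C"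
    using assms(1) by (rule eventually_mono) auto
  then have "{0<..<1} \<subseteq> ?C"
    using mem_closed_if_AE_lebesgue_open[OF open_greaterThanLessThan C] by (intro subsetI)
  then have "closure {0<..<1::real} \<subseteq> ?C" using C by (rule closure_minimal)
  then show ?thesis using x by (auto simp: closure_greaterThanLessThan)
qed

text \<open>The difference of the two functions has mean zero on every small interval, so it vanishes
  at its Lebesgue points. This is what identifies the two weak derivatives of \<open>u\<close> that
  \<open>regular_solution\<close> provides independently of each other.\<close>

lemma primitive_eq_imp_AE_eq:
  fixes F G :: "real \<Rightarrow> real"
  assumes F: "F absolutely_integrable_on {0..1}" and G: "G absolutely_integrable_on {0..1}"
    and eq: "\<And>x. x \<in> {0..1} \<Longrightarrow> integral {0..x} F = c + integral {0..x} G"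
  shows "AE x in lebesgue. x \<in> {0<..<1} \<longrightarrow> F x = G x"
proof -
  define D where "D x = (if x \<in> {0..1} then F x - G x else 0)" for x
  have i: "F integrable_on {x..y}" "G integrable_on {x..y}" if "0 \<le> x" "y \<le> 1" for x y
    using F G that set_lebesgue_integral_eq_integral(1) integrable_subinterval_real
    by (metis atLeastatMost_subset_iff)+
  have "(\<lambda>x. F x - G x) integrable_on {0..1}" using i by (intro integrable_diff) auto
  then have "D integrable_on UNIV" unfolding D_def by (subst integrable_restrict_UNIV)
  then have "D integrable_on cbox a b" for a b using integrable_on_subcbox by blast
  then obtain N where N: "negligible N"
    "\<And>x e. \<lbrakk>x \<notin> N; 0 < e\<rbrakk> \<Longrightarrow> \<exists>d>0. \<forall>h. 0 < h \<and> h < d \<longrightarrow>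
       norm (integral (cbox x (x + h *\<^sub>R One)) D /\<^sub>R h ^ DIM(real) - D x) < e"
    using integrable_ccontinuous_explicit[of D] by metis
  show ?thesis
  proof (rule negligible_AE_lebesgue[OF N(1)], intro impI)
    fix x assume x: "x \<notin> N" "x \<in> {0<..<1::real}"
    have "\<bar>D x\<bar> < e" if e: "e > 0" for e
    proof -
      obtain d where d: "d > 0" "\<And>h. 0 < h \<Longrightarrow> h < d \<Longrightarrow>
         norm (integral (cbox x (x + h *\<^sub>R One)) D /\<^sub>R h ^ DIM(real) - D x) < e"
        using N(2)[OF x(1) e] by auto
      define h where "h = min (d / 2) (1 - x)"
      have h: "0 < h" "h < d" "x + h \<le> 1" using d(1) x by (auto simp: h_def)
      have "integral {x..x+h} D = integral {x..x+h} (\<lambda>x. F x - G x)"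
        using x h by (intro integral_cong) (auto simp: D_def)
      also have "\<dots> = integral {x..x+h} F - integral {x..x+h} G"
        using x h by (intro integral_diff i) auto
      also have "\<dots> = 0"
        using integral_diff_lower[OF F, of x "x+h"] integral_diff_lower[OF G, of x "x+h"]
          eq[of x] eq[of "x+h"] x h by simp
      finally show ?thesis using d(2)[OF h(1,2)] by simp
    qed
    from this[of "\<bar>D x\<bar>"] have "D x = 0" by fastforce
    then show "F x = G x" using x by (simp add: D_def)
  qed
qed

lemma AE_integral_cong:
  fixes F G :: "real \<Rightarrow> real"
  assumes "AE x in lebesgue. x \<in> {0<..<1} \<longrightarrow> F x = G x" "x \<in> {0..1}"
  shows "integral {0..x} F = integral {0..x} G"
proof -
  obtain N where N: "negligible N" "\<And>x. x \<notin> N \<Longrightarrow> x \<in> {0<..<1} \<longrightarrow> F x = G x"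
    using assms(1) by (elim AE_lebesgue_negligible) auto
  show ?thesis
    by (rule integral_spike[of "insert 0 (insert 1 N)"]) (use N assms(2) in auto)
qed

lemma primitive_continuous:
  fixes g :: "real \<Rightarrow> real"
  assumes "g absolutely_integrable_on {0..1}"
  shows "continuous_on {0..1} (\<lambda>x. c + integral {0..x} g)"
  using assms set_lebesgue_integral_eq_integral(1)
  by (intro continuous_intros indefinite_integral_continuous_1) auto

section \<open>Classical regularity of regular solutions\<close>

text \<open>The passage from weak to classical derivatives. Since \<open>u\<close> is the primitive of a
  function \<open>v1\<close> which is itself almost everywhere equal to a continuous primitive \<open>V\<close>, it is
  continuously differentiable with \<open>u' = V\<close>. The flux \<open>V / sqrt (1 + V\<^sup>2)\<close> then equals, everywhere
  on \<open>[0, 1]\<close>, a primitive of \<open>g\<close>, and the Neumann condition at \<open>0\<close> makes the constant of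
  integration vanish.\<close>

lemma regular_solution_flux:
  assumes "regular_solution a f lam u"
  obtains V g where
    "\<And>x. x \<in> {0..1} \<Longrightarrow> (u has_real_derivative V x) (at x within {0..1})"
    "V 1 = 0"
    "g absolutely_integrable_on {0..1}"
    "AE x in lebesgue. x \<in> {0<..<1} \<longrightarrow> g x = - (lam * a x * f (u x))"
    "\<And>x. x \<in> {0..1} \<Longrightarrow> V x / sqrt (1 + (V x)\<^sup>2) = integral {0..x} g"
proof -
  note r = assms[unfolded regular_solution_def]
  have "sobolev_W1 2 {0<..<1} u" using r by (elim conjE)
  then obtain v1 v2 where w12: "has_weak_derivative {0<..<1} u v1" "has_weak_derivative {0<..<1} v1 v2"
    unfolding numeral_2_eq_2 sobolev_W1.simps by blast
  obtain v g where w: "has_weak_derivative {0<..<1} u v"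
      "has_weak_derivative {0<..<1} (\<lambda>x. v x / sqrt (1 + (v x)\<^sup>2)) g"
    and geq: "AE x in lebesgue_on {0<..<1}. - g x = lam * a x * f (u x)"
    using r by (elim conjE exE) 
  have u: "continuous_on {0..1} u" "(u has_real_derivative 0) (at 0 within {0..1})"
      "(u has_real_derivative 0) (at 1 within {0..1})"
    using r by blast+
  obtain c2 where v2: "v2 absolutely_integrable_on {0..1}"
    "AE x in lebesgue. x \<in> {0<..<1} \<longrightarrow> v1 x = c2 + integral {0..x} v2"
    by (rule weak_derivative_imp_primitive[OF w12(2)])
  define V where "V x = c2 + integral {0..x} v2" for x
  have V: "continuous_on {0..1} V" unfolding V_def by (rule primitive_continuous[OF v2(1)])
  have Vi: "V absolutely_integrable_on {0..1}" using V by (rule absolutely_integrable_continuous_real)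
  obtain c1 where v1: "v1 absolutely_integrable_on {0..1}"
    "AE x in lebesgue. x \<in> {0<..<1} \<longrightarrow> u x = c1 + integral {0..x} v1"
    by (rule weak_derivative_imp_primitive[OF w12(1)])
  obtain c where v: "v absolutely_integrable_on {0..1}"
    "AE x in lebesgue. x \<in> {0<..<1} \<longrightarrow> u x = c + integral {0..x} v"
    by (rule weak_derivative_imp_primitive[OF w(1)])
  obtain cg where g: "g absolutely_integrable_on {0..1}"
    "AE x in lebesgue. x \<in> {0<..<1} \<longrightarrow> v x / sqrt (1 + (v x)\<^sup>2) = cg + integral {0..x} g"
    by (rule weak_derivative_imp_primitive[OF w(2)])
  have uV: "u x = c1 + integral {0..x} V" if "x \<in> {0..1}" for x
    using AE_eq_imp_eq[OF v1(2) u(1) primitive_continuous[OF v1(1)] that]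
      AE_integral_cong[OF v2(2) that] by (simp add: V_def[abs_def])
  have uv: "u x = c + integral {0..x} v" if "x \<in> {0..1}" for x
    using AE_eq_imp_eq[OF v(2) u(1) primitive_continuous[OF v(1)] that] .
  have vV: "AE x in lebesgue. x \<in> {0<..<1} \<longrightarrow> v x = V x"
    by (rule primitive_eq_imp_AE_eq[OF v(1) Vi, of "c1 - c"]) (use uV uv in fastforce)
  have flux_AE: "AE x in lebesgue. x \<in> {0<..<1} \<longrightarrow> V x / sqrt (1 + (V x)\<^sup>2) = cg + integral {0..x} g"
    using g(2) vV by eventually_elim auto
  have "continuous_on {0..1} (\<lambda>x. V x / sqrt (1 + (V x)\<^sup>2))"
    using V by (intro continuous_intros) (auto simp: add_nonneg_eq_0_iff)
  note flux = AE_eq_imp_eq[OF flux_AE this primitive_continuous[OF g(1)]]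
  have der: "(u has_real_derivative V x) (at x within {0..1})" if x: "x \<in> {0..1}" for x
  proof -
    have "((\<lambda>x. c1 + integral {0..x} V) has_real_derivative V x) (at x within {0..1})"
      using DERIV_add[OF DERIV_const integral_has_real_derivative[OF V x]] by simp
    then show ?thesis
      by (rule has_field_derivative_transform_within[OF _ zero_less_one x]) (simp add: uV)
  qed
  \<comment> \<open>One-sided derivatives at the end points are unique, so the boundary conditions apply to \<open>V\<close>.\<close>
  have V0: "V x = 0" if "x \<in> {0..1}" "(u has_real_derivative 0) (at x within {0..1})" for x
    using vector_derivative_unique_within_closed_interval[of 0 1 x u "V x" 0] that der[OF that(1)]
    by (simp add: has_real_derivative_iff_has_vector_derivative)
  have "cg = 0" using flux[of 0] V0[of 0] u(2) by simp
  show thesis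
  proof (rule that[OF der _ g(1)])
    show "V 1 = 0" using V0 u(3) by simp
    show "AE x in lebesgue. x \<in> {0<..<1} \<longrightarrow> g x = - (lam * a x * f (u x))"
      using geq by (subst (asm) AE_lebesgue_on_iff) (auto elim!: eventually_mono)
    show "V x / sqrt (1 + (V x)\<^sup>2) = integral {0..x} g" if "x \<in> {0..1}" for x
      using flux[OF that] \<open>cg = 0\<close> by simp
  qed
qed

section \<open>Comparison with a circle\<close>

lemma slope_to_flux_strict_mono:
  fixes s t :: real
  assumes "s < t"
  shows "s / sqrt (1 + s\<^sup>2) < t / sqrt (1 + t\<^sup>2)"
proof (rule DERIV_pos_imp_increasing[OF assms, where f = "\<lambda>s. s / sqrt (1 + s\<^sup>2)"])
  fix x :: real
  have p: "1 + x\<^sup>2 > 0" by (simp add: add_pos_nonneg)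
  have "((\<lambda>s. s / sqrt (1 + s\<^sup>2)) has_real_derivative 1 / (sqrt (1 + x\<^sup>2)) ^ 3) (at x)"
    using p
    by (auto intro!: derivative_eq_intros simp: divide_simps power3_eq_cube power2_eq_square[symmetric])
       (simp add: field_simps power2_eq_square)?
  moreover have "0 < 1 / (sqrt (1 + x\<^sup>2)) ^ 3" using p by simp
  ultimately show "\<exists>y. DERIV (\<lambda>s. s / sqrt (1 + s\<^sup>2)) x :> y \<and> 0 < y" by blast
qed

lemma slope_to_flux_abs_less: "\<bar>s / sqrt (1 + s\<^sup>2)\<bar> < (1::real)"
proof -
  have p: "1 + s\<^sup>2 > 0" by (simp add: add_pos_nonneg)
  have "\<bar>s\<bar> < sqrt (1 + s\<^sup>2)" by (rule real_less_rsqrt) simp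
  then show ?thesis using p by (simp add: abs_divide)
qed

lemma slope_to_flux_inverse:
  fixes l :: real assumes "\<bar>l\<bar> < 1"
  defines "t \<equiv> l / sqrt (1 - l\<^sup>2)"
  shows "t / sqrt (1 + t\<^sup>2) = l"
proof -
  have p: "1 - l\<^sup>2 > 0" using assms(1) by (simp add: abs_square_less_1)
  have "1 + t\<^sup>2 = 1 / (1 - l\<^sup>2)" using p by (simp add: t_def power_divide field_simps)
  then have "sqrt (1 + t\<^sup>2) = 1 / sqrt (1 - l\<^sup>2)" by (simp add: real_sqrt_divide)
  then show ?thesis using p by (simp add: t_def)
qed

text \<open>A comparison with a circle of radius \<open>1 / K\<close>. The flux is the sine of the angle of
  inclination of the graph, and its derivative is the curvature. If the flux grows at least at rate
  \<open>K\<close> from a value not below \<open>- 1\<close>, then the graph is at no point steeper than the quarter circle that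
  starts vertically at \<open>s1\<close>, and that quarter circle descends by its radius only. The bound does not
  depend on how steep the graph is, nor on the length of the interval.\<close>

lemma curvature_bounds_drop:
  fixes u V :: "real \<Rightarrow> real"
  assumes K: "K > 0" and s: "s1 < s2"
    and cont: "continuous_on {s1..s2} u"
    and der: "\<And>x. s1 < x \<Longrightarrow> x < s2 \<Longrightarrow> (u has_real_derivative V x) (at x)"
    and flux: "\<And>x. x \<in> {s1..s2} \<Longrightarrow> K * (x - s1) - 1 \<le> V x / sqrt (1 + (V x)\<^sup>2)"
  shows "u s1 - u s2 \<le> 1 / K"
proof -
  \<comment> \<open>\<open>l\<close> is the flux of the quarter circle \<open>x \<mapsto> - sqrt (1 - (l x)\<^sup>2) / K\<close>.\<close>
  define l where "l x = K * (x - s1) - 1" for x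
  have l1: "l x < 1" if "x \<in> {s1..s2}" for x
    using flux[OF that] slope_to_flux_abs_less[of "V x"] unfolding l_def by linarith
  define P where "P x = u x + sqrt (1 - (l x)\<^sup>2) / K" for x
  have "P s1 \<le> P s2"
  proof (rule DERIV_nonneg_imp_increasing_open[of s1 s2 P])
    show "s1 \<le> s2" using s by simp
    show "continuous_on {s1..s2} P" unfolding P_def l_def
      using K by (intro continuous_intros cont) auto
    fix x assume x: "s1 < x" "x < s2"
    have lx: "\<bar>l x\<bar> < 1" using l1[of x] x K by (auto simp: l_def abs_less_iff)
    have p: "1 - (l x)\<^sup>2 > 0" using lx by (simp add: abs_square_less_1)
    have dl: "(l has_real_derivative K) (at x)"
      unfolding l_def by (auto intro!: derivative_eq_intros)
    have "(P has_real_derivative V x - l x / sqrt (1 - (l x)\<^sup>2)) (at x)"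
      unfolding P_def using K p
      by (auto intro!: derivative_eq_intros der[OF x] dl simp: field_simps)
    moreover have "l x / sqrt (1 - (l x)\<^sup>2) \<le> V x"
    proof (rule ccontr)
      assume "\<not> ?thesis"
      then have "V x / sqrt (1 + (V x)\<^sup>2) < l x"
        using slope_to_flux_strict_mono[of "V x" "l x / sqrt (1 - (l x)\<^sup>2)"]
          slope_to_flux_inverse[OF lx] by simp
      then show False using flux[of x] x by (simp add: l_def)
    qed
    ultimately show "\<exists>y. DERIV P x :> y \<and> 0 \<le> y" using diff_ge_0_iff_ge by blast
  qed
  moreover have "P s1 = u s1" by (simp add: P_def l_def)
  moreover have "sqrt (1 - (l s2)\<^sup>2) \<le> 1" by simp
  then have "P s2 \<le> u s2 + 1 / K"
    unfolding P_def using K by (intro add_left_mono divide_right_mono) auto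
  ultimately show ?thesis by simp
qed

section \<open>Profiles of positive Neumann solutions\<close>

lemma integral_mono_AE_interval:
  fixes F G :: "real \<Rightarrow> real"
  assumes "F absolutely_integrable_on {x..y}" "G absolutely_integrable_on {x..y}"
    and "AE t in lebesgue. t \<in> {x<..<y} \<longrightarrow> F t \<le> G t"
  shows "integral {x..y} F \<le> integral {x..y} G"
proof -
  obtain N where N: "negligible N" "\<And>t. t \<notin> N \<Longrightarrow> t \<in> {x<..<y} \<longrightarrow> F t \<le> G t"
    using assms(3) by (elim AE_lebesgue_negligible) auto
  have "AE t in lebesgue. t \<in> {x..y} \<longrightarrow> F t \<le> G t"
    by (rule negligible_AE_lebesgue[of "insert x (insert y N)"]) (use N in auto)
  from set_integral_mono_AE[OF assms(1,2) this]
  show ?thesis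
    using assms(1,2)[THEN set_lebesgue_integral_eq_integral(2)] by simp
qed

text \<open>A positive classical solution in first-order form: \<open>V\<close> is \<open>u'\<close>, and \<open>g\<close> is the almost
  everywhere derivative of the flux. Of the two boundary conditions, the one at \<open>0\<close> is contained in
  the last assumption, whose right-hand side vanishes there.\<close>

locale neumann_profile =
  fixes a f u V g :: "real \<Rightarrow> real" and lam z :: real
  assumes lam: "lam > 0" and z: "0 < z" "z < 1"
    and a_pos: "AE x in lebesgue. x \<in> {0<..<z} \<longrightarrow> a x > 0"
    and a_neg: "AE x in lebesgue. x \<in> {z<..<1} \<longrightarrow> a x < 0"
    and f_pos: "\<And>s. s > 0 \<Longrightarrow> f s > 0"
    and u_pos: "\<And>x. x \<in> {0..1} \<Longrightarrow> u x > 0"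
    and u_deriv: "\<And>x. x \<in> {0..1} \<Longrightarrow> (u has_real_derivative V x) (at x within {0..1})"
    and V1: "V 1 = 0"
    and g_int: "g absolutely_integrable_on {0..1}"
    and g_eq: "AE x in lebesgue. x \<in> {0<..<1} \<longrightarrow> g x = - (lam * a x * f (u x))"
    and flux: "\<And>x. x \<in> {0..1} \<Longrightarrow> V x / sqrt (1 + (V x)\<^sup>2) = integral {0..x} g"
begin

definition w :: "real \<Rightarrow> real" where
  "w x = integral {0..x} g"

lemma w_bound: "x \<in> {0..1} \<Longrightarrow> \<bar>w x\<bar> < 1"
  unfolding w_def using flux[of x] slope_to_flux_abs_less[of "V x"] by simp

lemma w_1: "w 1 = 0"
  using flux[of 1] V1 by (simp add: w_def)

lemma w_diff: "0 \<le> x \<Longrightarrow> x \<le> y \<Longrightarrow> y \<le> 1 \<Longrightarrow> w y - w x = integral {x..y} g"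
  unfolding w_def by (rule integral_diff_lower[OF g_int])

lemma g_int_sub: "0 \<le> x \<Longrightarrow> y \<le> 1 \<Longrightarrow> g absolutely_integrable_on {x..y}"
  by (rule absolutely_integrable_on_subinterval[OF g_int]) auto

lemma g_neg: "AE x in lebesgue. x \<in> {0<..<z} \<longrightarrow> g x < 0"
  using a_pos g_eq
proof eventually_elim
  case (elim x)
  then show ?case using lam f_pos[OF u_pos, of x] z by auto
qed

lemma g_pos: "AE x in lebesgue. x \<in> {z<..<1} \<longrightarrow> g x > 0"
  using a_neg g_eq
proof eventually_elim
  case (elim x)
  then show ?case using lam f_pos[OF u_pos, of x] z by (auto simp: mult_neg_pos mult_pos_neg)
qed

text \<open>The flux increases strictly on \<open>[z, 1]\<close> and ends with the value \<open>0\<close>.\<close>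

lemma w_neg:
  assumes "z \<le> x" "x < 1"
  shows "w x < 0"
proof -
  have int: "g absolutely_integrable_on {x..1}" using assms z by (intro g_int_sub) auto
  have nn: "AE t in lebesgue. t \<in> {x<..<1} \<longrightarrow> 0 < g t"
    using g_pos by eventually_elim (use assms in auto)
  have "AE t in lebesgue. t \<in> {x<..<1} \<longrightarrow> 0 \<le> g t"
    using nn by eventually_elim auto
  then have "0 \<le> integral {x..1} g"
    using integral_mono_AE_interval[where F = "\<lambda>_. 0" and x = x and y = 1 and G = g] int by simp
  moreover have "integral {x..1} g \<noteq> 0"
  proof
    assume "integral {x..1} g = 0"
    then have 0: "(LINT t:{x<..<1}|lebesgue. g t) = 0"
      using set_lebesgue_integral_eq_integral(2)[of "{x<..<1}" g] int
        absolutely_integrable_on_open_interval[where f = g and a = x and b = 1]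
      by (simp add: integral_open_interval_real)
    have i: "integrable lebesgue (\<lambda>t. indicator {x<..<1} t *\<^sub>R g t)"
      using int absolutely_integrable_on_open_interval[where f = g and a = x and b = 1]
      by (simp add: set_integrable_def)
    have "AE t in lebesgue. 0 \<le> indicator {x<..<1} t *\<^sub>R g t"
      using nn by eventually_elim (auto simp: indicator_def)
    then have "AE t in lebesgue. indicator {x<..<1} t *\<^sub>R g t = 0"
      using integral_nonneg_eq_0_iff_AE[OF i] 0 by (simp add: set_lebesgue_integral_def)
    with nn have "AE t in lebesgue. t \<notin> {x<..<1}"
      by eventually_elim (auto simp: indicator_def split: if_splits)
    then obtain N where N: "negligible N" "\<And>t. t \<notin> N \<Longrightarrow> t \<notin> {x<..<1}"
      by (elim AE_lebesgue_negligible) auto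
    then have "negligible {x<..<1}" by (meson negligible_subset subsetI)
    then show False using open_not_negligible[of "{x<..<1}"] assms by auto
  qed
  ultimately have "0 < integral {x..1} g" by simp
  then show ?thesis using w_diff[of x 1] w_1 assms z by simp
qed

lemma w_nonpos:
  assumes "x \<in> {0..1}"
  shows "w x \<le> 0"
proof (cases "x \<le> z")
  case True
  have "AE t in lebesgue. t \<in> {0<..<x} \<longrightarrow> g t \<le> 0"
    using g_neg by eventually_elim (use True in auto)
  then have "integral {0..x} g \<le> integral {0..x} (\<lambda>_. 0)"
    using assms g_int_sub by (intro integral_mono_AE_interval) auto
  then show ?thesis by (simp add: w_def)
next
  case False
  then show ?thesis using w_neg[of x] w_1 assms by (cases "x = 1") auto
qed

lemma u_cont: "continuous_on {0..1} u"
  by (rule DERIV_continuous_on[OF u_deriv])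

lemma u_deriv_at: "0 < x \<Longrightarrow> x < 1 \<Longrightarrow> (u has_real_derivative V x) (at x)"
  using u_deriv[of x] at_within_Icc_at[of 0 x 1] by simp

lemma u_antimono:
  assumes "0 \<le> x" "x \<le> y" "y \<le> 1"
  shows "u y \<le> u x"
proof (rule DERIV_nonpos_imp_decreasing_open[OF assms(2), of u])
  show "continuous_on {x..y} u" using u_cont by (rule continuous_on_subset) (use assms in auto)
  fix t assume t: "x < t" "t < y"
  have "V t \<le> 0"
  proof (rule ccontr)
    assume "\<not> V t \<le> 0"
    then have "V t / sqrt (1 + (V t)\<^sup>2) > 0" by (intro divide_pos_pos) (auto intro: add_pos_nonneg)
    then show False using w_nonpos[of t] flux[of t] t assms by (simp add: w_def)
  qed
  then show "\<exists>y. DERIV u t :> y \<and> y \<le> 0" using u_deriv_at[of t] t assms by auto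
qed

lemma w_growth:
  assumes "0 \<le> x" "x \<le> y" "y \<le> 1"
    and a: "AE t in lebesgue. t \<in> {x<..<y} \<longrightarrow> a t \<le> - c"
    and m: "\<And>t. t \<in> {x..y} \<Longrightarrow> m \<le> f (u t)" and "0 \<le> c" "0 \<le> m"
  shows "lam * c * m * (y - x) \<le> w y - w x"
proof -
  have "AE t in lebesgue. t \<in> {x<..<y} \<longrightarrow> lam * c * m \<le> g t"
    using a g_eq
  proof eventually_elim
    case (elim t)
    show ?case
    proof
      assume t: "t \<in> {x<..<y}"
      have "c * m \<le> - a t * f (u t)"
        using elim t m[of t] assms(6,7) by (intro mult_mono) auto
      then have "lam * (c * m) \<le> lam * (- a t * f (u t))"
        using lam by (intro mult_left_mono) auto
      then show "lam * c * m \<le> g t" using elim t assms by (simp add: mult.assoc)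
    qed
  qed
  then have "integral {x..y} (\<lambda>_. lam * c * m) \<le> integral {x..y} g"
    using assms by (intro integral_mono_AE_interval g_int_sub absolutely_integrable_continuous_real) auto
  moreover have "integral {x..y} (\<lambda>_. lam * c * m) = lam * c * m * (y - x)"
    using assms(2) by simp
  ultimately show ?thesis unfolding w_diff[OF assms(1-3)] by (simp only:)
qed

text \<open>Here the point \<open>xo\<close> of vanishing mean of the weight enters. If \<open>u\<close> stayed above \<open>M\<close> on
  \<open>[0, xo]\<close>, then \<open>f (u t)\<close> would be nondecreasing in \<open>t\<close>, so that replacing it by its value at the
  sign change \<open>z\<close> of the weight would only increase the integral of \<open>a t * f (u t)\<close>. But the
  integral with the constant \<open>f (u z)\<close> is zero, so the flux at \<open>xo\<close> would be nonnegative, which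
  \<open>w_neg\<close> forbids.\<close>

lemma u_below_maximum:
  assumes xo: "z < xo" "xo < 1" and a: "a absolutely_integrable_on {0..xo}" "integral {0..xo} a = 0"
    and f: "\<And>s t. M \<le> s \<Longrightarrow> s \<le> t \<Longrightarrow> f t \<le> f s"
  shows "u xo < M"
proof (rule ccontr)
  assume "\<not> u xo < M"
  then have uM: "M \<le> u t" if "t \<in> {0..xo}" for t
    using u_antimono[of t xo] that xo by auto
  have "AE t in lebesgue. t \<noteq> z"
    by (rule negligible_AE_lebesgue[of "{z}"]) auto
  with a_pos a_neg g_eq
  have "AE t in lebesgue. t \<in> {0<..<xo} \<longrightarrow> - (lam * f (u z)) * a t \<le> g t"
  proof eventually_elim
    case (elim t)
    show ?case
    proof
      assume t: "t \<in> {0<..<xo}"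
      have "a t * f (u t) \<le> a t * f (u z)"
      proof (cases "t < z")
        case True
        then have "f (u t) \<le> f (u z)" using t uM[of z] u_antimono[of t z] xo z by (intro f) auto
        then show ?thesis using elim(1) t True by (intro mult_left_mono) auto
      next
        case False
        then have "f (u z) \<le> f (u t)" using t uM[of t] u_antimono[of z t] xo z by (intro f) auto
        then show ?thesis using elim t False xo by (intro mult_left_mono_neg) auto
      qed
      then have "lam * (a t * f (u t)) \<le> lam * (a t * f (u z))" using lam by simp
      then show "- (lam * f (u z)) * a t \<le> g t" using elim t xo by (simp add: algebra_simps)
    qed
  qed
  then have "integral {0..xo} (\<lambda>t. - (lam * f (u z)) * a t) \<le> integral {0..xo} g"
    using a(1) xo by (intro integral_mono_AE_interval g_int_sub set_integrable_mult_right) auto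
  then have "0 \<le> w xo" using a(2) by (simp add: w_def)
  then show False using w_neg[of xo] xo by simp
qed

text \<open>Both halves of the argument use that the flux has values in \<open>(- 1, 0]\<close> on \<open>[y1, xo]\<close>, where
  it grows at rate at least \<open>lam * c * f (u t)\<close>. While \<open>u\<close> descends from \<open>M + 1\<close> to \<open>M\<close> this rate is
  at least \<open>lam * c * f (M + 1)\<close>, and the circle comparison does not allow a descent by \<open>1\<close> when this
  number exceeds \<open>1\<close>; as \<open>u\<close> is below \<open>M\<close> at \<open>xo\<close>, it is at most \<open>M + 1\<close> already at \<open>y1\<close>. On
  \<open>[y1, y2]\<close> the total growth is less than \<open>1\<close>, so \<open>f (u t)\<close> cannot be large throughout.\<close>

lemma decay:
  assumes y: "0 \<le> y1" "y1 < y2" "y2 \<le> xo" "xo \<le> 1" and uxo: "u xo < M"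
    and M: "M > 0"
    and f: "\<And>s t. M \<le> s \<Longrightarrow> s \<le> t \<Longrightarrow> f t \<le> f s"
    and c: "c > 0" and a: "AE t in lebesgue. t \<in> {y1<..<xo} \<longrightarrow> a t \<le> - c"
    and large: "lam * c * f (M + 1) > 1"
  obtains t where "t \<in> {y1..y2}" "u t \<le> M + 1" "f (u t) \<le> 1 / (lam * c * (y2 - y1))"
proof -
  have fM: "f (M + 1) > 0" using f_pos M by simp
  define K where "K = lam * c * f (M + 1)"
  have K: "K > 1" using large by (simp add: K_def)
  have u1: "u y1 \<le> M + 1"
  proof (rule ccontr)
    assume "\<not> u y1 \<le> M + 1"
    then obtain s1 where s1: "y1 \<le> s1" "s1 \<le> xo" "u s1 = M + 1"
      using IVT2'[of u xo "M + 1" y1] uxo y continuous_on_subset[OF u_cont, of "{y1..xo}"] by force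
    then obtain s2 where s2: "s1 \<le> s2" "s2 \<le> xo" "u s2 = M"
      using IVT2'[of u xo M s1] uxo y continuous_on_subset[OF u_cont, of "{s1..xo}"] by force
    have less: "s1 < s2" using s1 s2 by (cases "s1 = s2") auto
    have "u s1 - u s2 \<le> 1 / K"
    proof (rule curvature_bounds_drop[OF _ less])
      show "K > 0" using K by simp
      show "continuous_on {s1..s2} u" using u_cont by (rule continuous_on_subset) (use s1 s2 y in auto)
      show "(u has_real_derivative V x) (at x)" if "s1 < x" "x < s2" for x
        using that s1 s2 y by (intro u_deriv_at) auto
      show "K * (x - s1) - 1 \<le> V x / sqrt (1 + (V x)\<^sup>2)" if x: "x \<in> {s1..s2}" for x
      proof -
        have "lam * c * f (M + 1) * (x - s1) \<le> w x - w s1"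
        proof (rule w_growth)
          show "AE t in lebesgue. t \<in> {s1<..<x} \<longrightarrow> a t \<le> - c"
            using a by eventually_elim (use s1 s2 x in auto)
          fix t assume t: "t \<in> {s1..x}"
          show "f (M + 1) \<le> f (u t)"
            using u_antimono[of s1 t] u_antimono[of t s2] s1 s2 x t y by (intro f) auto
        qed (use s1 s2 x y c fM in auto)
        moreover have "w s1 > -1" using w_bound[of s1] s1 s2 y by auto
        moreover have "V x / sqrt (1 + (V x)\<^sup>2) = w x" using flux[of x] x s1 s2 y by (simp add: w_def)
        ultimately show ?thesis unfolding K_def by linarith
      qed
    qed
    moreover have "1 / K < 1" using K by simp
    ultimately show False using s1 s2 by simp
  qed
  define B where "B = 1 / (lam * c * (y2 - y1))"
  have pos: "lam * c * (y2 - y1) > 0" using lam c y by simp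
  have "\<exists>t\<in>{y1..y2}. f (u t) \<le> B"
  proof (rule ccontr)
    assume n: "\<not> (\<exists>t\<in>{y1..y2}. f (u t) \<le> B)"
    have "lam * c * B * (y2 - y1) \<le> w y2 - w y1"
    proof (rule w_growth)
      show "AE t in lebesgue. t \<in> {y1<..<y2} \<longrightarrow> a t \<le> - c"
        using a by eventually_elim (use y in auto)
      show "B \<le> f (u t)" if "t \<in> {y1..y2}" for t using n that by force
    qed (use y c pos in \<open>auto simp: B_def\<close>)
    moreover have "lam * c * B * (y2 - y1) = 1" using pos unfolding B_def by (auto simp: field_simps)
    moreover have "w y2 \<le> 0" using w_nonpos y by simp
    moreover have "w y1 > -1" using w_bound[of y1] y by simp
    ultimately show False by linarith
  qed
  then obtain t where t: "t \<in> {y1..y2}" "f (u t) \<le> B" by blast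
  show thesis
    using that[OF t(1)] t u1 u_antimono[of y1 t] y by (simp add: B_def)
qed

end

section \<open>Decay beyond the sign change of the weight\<close>

text \<open>The behaviour at \<open>0\<close> gives the bound near \<open>0\<close>, and the positive minimum of \<open>f\<close> gives it
  on the remaining compact interval.\<close>

lemma power_lower_bound:
  fixes f :: "real \<Rightarrow> real"
  assumes "continuous_on UNIV f" "\<And>s. s > 0 \<Longrightarrow> f s > 0" "p > 0"
    and lim: "((\<lambda>s. f s / s powr p) \<longlongrightarrow> 1) (at_right 0)" and B: "B > 0"
  obtains \<kappa> where "\<kappa> > 0" "\<And>s. 0 < s \<Longrightarrow> s \<le> B \<Longrightarrow> \<kappa> * s powr p \<le> f s"
proof -
  have "\<forall>\<^sub>F s in at_right 0. 1/2 < f s / s powr p"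
    using order_tendstoD(1)[OF lim, of "1/2"] by simp
  then obtain d where d: "d > 0" "\<And>s. 0 < s \<Longrightarrow> s < d \<Longrightarrow> 1/2 < f s / s powr p"
    by (auto simp: eventually_at_right_field)
  define e where "e = min d B"
  have e: "0 < e" "e \<le> B" "e \<le> d" using d B by (auto simp: e_def)
  obtain m where m: "m \<in> {e..B}" "\<And>s. s \<in> {e..B} \<Longrightarrow> f m \<le> f s"
    using continuous_attains_inf[of "{e..B}" f] e assms(1) continuous_on_subset
    by (metis atLeastAtMost_iff compact_Icc empty_iff order_refl subset_UNIV)
  have fm: "f m > 0" using assms(2) m(1) e by simp
  have Bp: "B powr p > 0" using B by simp
  show thesis
  proof
    show "min (1/2) (f m / B powr p) > 0" using fm Bp by simp
    fix s assume s: "0 < s" "s \<le> B"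
    show "min (1/2) (f m / B powr p) * s powr p \<le> f s"
    proof (cases "s < e")
      case True
      then have "1/2 * s powr p \<le> f s" using d(2)[of s] s e by (simp add: field_simps)
      moreover have "min (1/2) (f m / B powr p) * s powr p \<le> 1/2 * s powr p"
        by (intro mult_right_mono min.cobounded1) simp
      ultimately show ?thesis by linarith
    next
      case False
      have "min (1/2) (f m / B powr p) * s powr p \<le> (f m / B powr p) * B powr p"
        using s fm assms(3) by (intro mult_mono powr_mono2) auto
      also have "\<dots> = f m" using Bp by simp
      also have "\<dots> \<le> f s" using m(2) False s by simp
      finally show ?thesis .
    qed
  qed
qed

theorem theorem6p2:
  fixes a f :: "real \<Rightarrow> real"
    and z x\<^sub>\<omega> h p q M :: real
    and lam :: "nat \<Rightarrow> real"
    and u :: "nat \<Rightarrow> real \<Rightarrow> real"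
  assumes a_bounded: "essentially_bounded {0<..<1} a"
    and a_mean: "(LINT x|lebesgue_on {0<..<1}. a x) < 0"
    and z: "z \<in> {0<..<1}"
    and a_pos: "AE x in lebesgue_on {0<..<z}. a x > 0"
    and a_neg: "AE x in lebesgue_on {z<..<1}. a x < 0"
    and x_omega: "x\<^sub>\<omega> \<in> {z<..<1}" "(LINT x|lebesgue_on {0<..<x\<^sub>\<omega>}. a x) = 0"
    and a_esssup: "\<forall>\<^sub>F \<epsilon> in at_right 0.
                     esssup (lebesgue_on {z + \<epsilon>..x\<^sub>\<omega>}) (\<lambda>x. ereal (a x)) < 0"
    and f_cont: "continuous_on UNIV f"
    and f_zero: "f 0 = 0"
    and f_pos: "\<forall>s>0. f s > 0"
    and hpq: "h > 0" "p > 0" "q \<in> {0<..<1}"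
    and f_at_0: "((\<lambda>s. f s / s powr p) \<longlongrightarrow> 1) (at_right 0)"
    and f_at_top: "((\<lambda>s. f s / s powr (- q)) \<longlongrightarrow> h) at_top"
    and M_pos: "M > 0"
    and M_max: "\<forall>s\<ge>0. f s \<le> f M"
    and M_maximal: "\<forall>m\<ge>0. (\<forall>s\<ge>0. f s \<le> f m) \<longrightarrow> m \<le> M"
    and f_C1: "C1_on_atLeast M f"
    and f_incr: "strict_mono_on {0<..<M} f"
    and f_decr: "strict_antimono_on {M<..} f"
    and u_sol: "\<forall>n\<ge>1. regular_solution a f (lam n) (u n) \<and> strictly_positive (u n)"
    and lam_lim: "filterlim lam at_top sequentially"
    and u_liminf: "liminf (\<lambda>n. ereal (u n 0)) > 0"
  shows "\<forall>\<eta>\<in>{0<..<1 - z}. \<exists>C>0. \<exists>n\<^sub>0\<ge>1. \<forall>n\<ge>n\<^sub>0. \<forall>x\<in>{z + \<eta>..1}.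
           u n x \<le> C * lam n powr (- 1 / p)"
proof
  fix \<eta> assume \<eta>: "\<eta> \<in> {0<..<1 - z}"
  have pos: "AE x in lebesgue. x \<in> {0<..<z} \<longrightarrow> a x > 0"
    and neg: "AE x in lebesgue. x \<in> {z<..<1} \<longrightarrow> a x < 0"
    using a_pos a_neg by (simp_all add: AE_lebesgue_on_iff)
  have "integrable (lebesgue_on {0<..<1}) a"
    using a_mean not_integrable_integral_eq[of "lebesgue_on {0<..<1}" a] by fastforce
  then have a1: "a absolutely_integrable_on {0..1}" by (rule abs_integrable_unit)
  have a_int: "a absolutely_integrable_on {0..x\<^sub>\<omega>}"
    by (rule absolutely_integrable_on_subinterval[OF a1]) (use x_omega(1) in auto)
  have "a absolutely_integrable_on {0<..<x\<^sub>\<omega>}"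
    using a_int absolutely_integrable_on_open_interval[where f = a and a = 0 and b = x\<^sub>\<omega>] by simp
  then have "integrable (lebesgue_on {0<..<x\<^sub>\<omega>}) a"
    by (simp add: set_integrable_def integrable_restrict_space)
  then have a_zero: "integral {0..x\<^sub>\<omega>} a = 0"
    using lebesgue_integral_eq_integral[of "{0<..<x\<^sub>\<omega>}" a] x_omega(2)
    by (simp add: integral_open_interval_real)
  have f_anti: "f t \<le> f s" if "M \<le> s" "s \<le> t" for s t
  proof (cases "s = M \<or> s = t")
    case True
    then show ?thesis using that M_max M_pos by auto
  next
    case False
    then show ?thesis using that monotone_onD[OF f_decr, of s t] by simp
  qed
  \<comment> \<open>The bound on \<open>a\<close> is available only up to \<open>x\<^sub>\<omega>\<close>, so the estimate is made at a point of
    \<open>[z + \<delta>/2, z + \<delta>]\<close> to the left of \<open>x\<^sub>\<omega>\<close>, and the monotonicity of \<open>u n\<close> carries it over to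
    \<open>[z + \<eta>, 1]\<close>.\<close>
  define \<delta> where "\<delta> = min \<eta> (x\<^sub>\<omega> - z)"
  have \<delta>: "0 < \<delta>" "\<delta> \<le> \<eta>" "z + \<delta> \<le> x\<^sub>\<omega>" using \<eta> x_omega(1) by (auto simp: \<delta>_def)
  obtain b where b: "b > 0" "\<And>\<epsilon>. 0 < \<epsilon> \<Longrightarrow> \<epsilon> < b \<Longrightarrow>
      esssup (lebesgue_on {z + \<epsilon>..x\<^sub>\<omega>}) (\<lambda>x. ereal (a x)) < 0"
    using a_esssup by (auto simp: eventually_at_right_field)
  define \<epsilon> where "\<epsilon> = min (b / 2) (\<delta> / 2)"
  have \<epsilon>: "0 < \<epsilon>" "\<epsilon> < b" "\<epsilon> \<le> \<delta> / 2" using b(1) \<delta> by (auto simp: \<epsilon>_def)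
  obtain r where r: "esssup (lebesgue_on {z + \<epsilon>..x\<^sub>\<omega>}) (\<lambda>x. ereal (a x)) < ereal r" "ereal r < 0"
    using ereal_dense2[OF b(2)[OF \<epsilon>(1,2)]] by auto
  define c where "c = - r"
  have c: "c > 0" using r(2) by (simp add: c_def)
  have "AE x in lebesgue_on {z + \<epsilon>..x\<^sub>\<omega>}. a x \<le> - c"
    using esssup_AE[of "\<lambda>x. ereal (a x)" "lebesgue_on {z + \<epsilon>..x\<^sub>\<omega>}"]
  proof (rule eventually_mono)
    fix x assume "ereal (a x) \<le> esssup (lebesgue_on {z + \<epsilon>..x\<^sub>\<omega>}) (\<lambda>x. ereal (a x))"
    then have "ereal (a x) < ereal r" using r(1) by (rule le_less_trans)
    then show "a x \<le> - c" by (simp add: c_def)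
  qed
  then have "AE x in lebesgue. x \<in> {z + \<epsilon>..x\<^sub>\<omega>} \<longrightarrow> a x \<le> - c"
    by (simp add: AE_lebesgue_on_iff)
  then have ac: "AE x in lebesgue. x \<in> {z + \<delta> / 2<..<x\<^sub>\<omega>} \<longrightarrow> a x \<le> - c"
    by eventually_elim (use \<epsilon> in auto)
  have fp: "\<And>s. s > 0 \<Longrightarrow> f s > 0" using f_pos by simp
  obtain \<kappa> where \<kappa>: "\<kappa> > 0" "\<And>s. 0 < s \<Longrightarrow> s \<le> M + 1 \<Longrightarrow> \<kappa> * s powr p \<le> f s"
    using power_lower_bound[OF f_cont fp hpq(2) f_at_0, of "M + 1"] M_pos by auto
  have fM: "f (M + 1) > 0" using fp M_pos by simp
  define D where "D = 1 / (\<kappa> * (c * (\<delta> / 2)))"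
  have D: "D > 0" using \<kappa>(1) c \<delta>(1) by (simp add: D_def)
  have "\<forall>\<^sub>F n in sequentially. max 0 (1 / (c * f (M + 1))) < lam n"
    using lam_lim unfolding filterlim_at_top_dense by blast
  then obtain n0 where n0: "\<And>n. n \<ge> n0 \<Longrightarrow> max 0 (1 / (c * f (M + 1))) < lam n"
    by (auto simp: eventually_sequentially)
  have bound: "u n x \<le> D powr (1 / p) * lam n powr (- 1 / p)"
    if n: "n \<ge> max 1 n0" and x: "x \<in> {z + \<eta>..1}" for n x
  proof -
    have lam_n: "lam n > 0" "lam n * c * f (M + 1) > 1"
      using n0[of n] n c fM by (auto simp: field_simps)
    have sol: "regular_solution a f (lam n) (u n)" "strictly_positive (u n)"
      using u_sol n by auto
    have "continuous_on {0..1} (u n)" using sol(1) by (simp add: regular_solution_def)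
    then have "bdd_below (u n ` {0..1})"
      by (intro bounded_imp_bdd_below compact_imp_bounded compact_continuous_image) auto
    then have u_pos: "u n t > 0" if "t \<in> {0..1}" for t
      using sol(2) cINF_lower[of "u n" "{0..1}" t] that
      unfolding strictly_positive_def by fastforce
    obtain V g where Vg: "\<And>x. x \<in> {0..1} \<Longrightarrow> (u n has_real_derivative V x) (at x within {0..1})"
      "V 1 = 0" "g absolutely_integrable_on {0..1}"
      "AE x in lebesgue. x \<in> {0<..<1} \<longrightarrow> g x = - (lam n * a x * f (u n x))"
      "\<And>x. x \<in> {0..1} \<Longrightarrow> V x / sqrt (1 + (V x)\<^sup>2) = integral {0..x} g"
      using regular_solution_flux[OF sol(1)] by blast
    interpret neumann_profile a f "u n" V g "lam n" z
      using lam_n(1) z pos neg fp u_pos Vg by unfold_locales auto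
    have "u n x\<^sub>\<omega> < M"
      using u_below_maximum[OF _ _ a_int a_zero f_anti] x_omega(1) by auto
    then obtain t where t: "t \<in> {z + \<delta> / 2..z + \<delta>}" "u n t \<le> M + 1"
      "f (u n t) \<le> 1 / (lam n * c * (z + \<delta> - (z + \<delta> / 2)))"
      using decay[of "z + \<delta> / 2" "z + \<delta>" x\<^sub>\<omega> M c] z x_omega(1) \<delta> M_pos f_anti c ac lam_n(2)
      by auto
    have ut: "u n t > 0" using t(1) z x_omega(1) \<delta> by (intro u_pos) auto
    have "\<kappa> * u n t powr p \<le> 1 / (lam n * c * (\<delta> / 2))"
      using \<kappa>(2)[OF ut t(2)] t(3) by simp
    then have "u n t powr p \<le> D / lam n"
      unfolding D_def using \<kappa>(1) lam_n(1) c \<delta>(1) by (simp add: field_simps)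
    then have "(u n t powr p) powr (1 / p) \<le> (D / lam n) powr (1 / p)"
      using hpq(2) by (intro powr_mono2) auto
    also have "(u n t powr p) powr (1 / p) = u n t" using hpq(2) ut by (simp add: powr_powr)
    also have "(D / lam n) powr (1 / p) = D powr (1 / p) * lam n powr (- 1 / p)"
      using D lam_n(1) powr_divide[of D "lam n" "1 / p"] powr_minus_divide[of "lam n" "1 / p"] by simp
    finally have "u n t \<le> D powr (1 / p) * lam n powr (- 1 / p)" .
    moreover have "u n x \<le> u n t" using t(1) x z \<delta> by (intro u_antimono) auto
    ultimately show ?thesis by simp
  qed
  show "\<exists>C>0. \<exists>n\<^sub>0\<ge>1. \<forall>n\<ge>n\<^sub>0. \<forall>x\<in>{z + \<eta>..1}. u n x \<le> C * lam n powr (- 1 / p)"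
    using bound D by (intro exI[of _ "D powr (1 / p)"] conjI exI[of _ "max 1 n0"]) auto
qed

end
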